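(* Let $$\mathbb{B}_1=\{(n_1,n_2)\in\mathbb{N}\times\mathbb{N}:n_1<n_2,\ \lambda_{n_1}+\lambda_{n_2}<-\beta\ \text{and}\ \lambda_{n_1}\lambda_{n_2}=2k\},$$ $$\mathbb{B}_2=\{(n_1,n_2)\in\mathbb{N}\times\mathbb{N}:n_1<n_2,\ \lambda_{n_2}<-\beta\ \text{and}\ \lambda_{n_1}(\lambda_{n_2}-\lambda_{n_1})=2k\},$$ and $\mathbb{B}=\mathbb{B}_1\cup\mathbb{B}_2$. The system $$A^2u+C_uAu+k(u-v)=0,\qquad A^2v+C_vAv-k(u-v)=0,$$ with $C_u=\beta+\varrho\|u\|_1^2$, $C_v=\beta+\varrho\|v\|_1^2$, admits bimodal equidistributed energy solutions if and only if $\mathbb{B}$ is nonempty. More precisely, for every couple $(n_1,n_2)\in\mathbb{N}\times\mathbb{N}$ with $n_1<n_2$, one of the following disjoint situations occurs. (1) If $(n_1,n_2)\in\mathbb{B}_1$, the bimodal equidistributed energy solutions involving $e_{n_1}$ and $e_{n_2}$ are exactly the (infinitely many) couples $$u=xe_{n_1}+ye_{n_2},\qquad v=-xe_{n_1}-ye_{n_2},$$ for all $(x,y)\in\mathbb{R}^2$ satisfying $\varrho x^2\lambda_{n_1}+\varrho y^2\lambda_{n_2}+\lambda_{n_1}+\lambda_{n_2}+\beta=0$ with $xy\neq0$. (2) If $(n_1,n_2)\in\mathbb{B}_2$, the bimodal equidistributed energy solutions involving $e_{n_1}$ and $e_{n_2}$ are exactly the (infinitely many) couples $$u=xe_{n_1}+ye_{n_2},\qquad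 v=-xe_{n_1}+ye_{n_2},$$ for all $(x,y)\in\mathbb{R}^2$ satisfying $\varrho x^2\lambda_{n_1}+\varrho y^2\lambda_{n_2}+\lambda_{n_2}+\beta=0$ with $xy\neq0$. (3) If $(n_1,n_2)\notin\mathbb{B}$, there are no bimodal equidistributed energy solutions involving the eigenvectors $e_{n_1}$ and $e_{n_2}$.
   Context: Let $H$ be a separable real Hilbert space with inner product $\langle\cdot,\cdot\rangle$ and norm $\|\cdot\|$, and let $A:D(A)\subset H\to H$ be a strictly positive selfadjoint linear operator whose domain is densely and compactly embedded in $H$. For $r\ge0$ set $H^r=D(A^{r/2})$, $\langle u,v\rangle_r=\langle A^{r/2}u,A^{r/2}v\rangle$, $\|u\|_r=\|A^{r/2}u\|$. All eigenvalues of $A$ are assumed simple; they form the increasing sequence $0<\lambda_1<\lambda_2<\cdots\to\infty$ ($n\in\mathbb{N}=\{1,2,3,\dots\}$), and the corresponding normalized eigenvectors $e_n$ form a complete orthonormal basis of $H$. Fix $\beta\in\mathbb{R}$ and $\varrho,k>0$. A (weak) solution of the system is a couple $(u,v)\in H^2\times H^2$ such that $$\langle u,\phi\rangle_2+C_u\langle u,\phi\rangle_1+k\langle u-v,\phi\rangle=0,\qquad \langle v,\psi\rangle_2+C_v\langle v,\psi\rangle_1-k\langle u-v,\psi\rangle=0$$ for every $(\phi,\psi)\in H^2\times H^2$. A solution is bimodal, involving $e_{n_1}$ and $e_{n_2}$ ($n_1\ne n_2$), if $u=\alpha_{n_1}e_{n_1}+\alpha_{n_2}e_{n_2}$ and $v=\gamma_{n_1}e_{n_1}+\gamma_{n_2}e_{n_2}$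 with all of $\alpha_{n_1},\alpha_{n_2},\gamma_{n_1},\gamma_{n_2}$ nonzero reals. An equidistributed energy solution is a nontrivial solution $(u,v)$ with $\|u\|_1=\|v\|_1$ (equivalently $C_u=C_v$). *)

theory Defs
  imports "HOL-Analysis.Analysis"
begin

text \<open>An unbounded operator is a pair of a domain \<open>D\<close> and a function \<open>A\<close>; the values of
  \<open>A\<close> outside \<open>D\<close> are irrelevant.\<close>

definition linear_operator :: "'a::real_vector set \<Rightarrow> ('a \<Rightarrow> 'a) \<Rightarrow> bool" where
  "linear_operator D A \<longleftrightarrow> subspace D \<and>
     (\<forall>u\<in>D. \<forall>v\<in>D. A (u + v) = A u + A v) \<and> (\<forall>c. \<forall>u\<in>D. A (c *\<^sub>R u) = c *\<^sub>R A u)"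

text \<open>The last conjunct says that the graph of the adjoint of \<open>A\<close> equals the graph of \<open>A\<close>, which
  includes the equality of the domains.\<close>

definition selfadjoint_operator :: "'a::real_inner set \<Rightarrow> ('a \<Rightarrow> 'a) \<Rightarrow> bool" where
  "selfadjoint_operator D A \<longleftrightarrow> linear_operator D A \<and> closure D = UNIV \<and>
     (\<forall>w z. (\<forall>u\<in>D. A u \<bullet> w = u \<bullet> z) \<longleftrightarrow> w \<in> D \<and> A w = z)"

definition strictly_positive_operator :: "'a::real_inner set \<Rightarrow> ('a \<Rightarrow> 'a) \<Rightarrow> bool" where
  "strictly_positive_operator D A \<longleftrightarrow> (\<exists>c>0. \<forall>u\<in>D. A u \<bullet> u \<ge> c * (norm u)\<^sup>2)"

text \<open>Compactness of the embedding of \<open>D\<close>, with the graph norm, into the ambient space.\<close>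

definition compactly_embedded_domain :: "'a::real_normed_vector set \<Rightarrow> ('a \<Rightarrow> 'a) \<Rightarrow> bool" where
  "compactly_embedded_domain D A \<longleftrightarrow> compact (closure {u \<in> D. norm u + norm (A u) \<le> 1})"

definition eigenspace :: "'a::real_vector set \<Rightarrow> ('a \<Rightarrow> 'a) \<Rightarrow> real \<Rightarrow> 'a set" where
  "eigenspace D A \<mu> = {u \<in> D. A u = \<mu> *\<^sub>R u}"

definition eigenvalues :: "'a::real_vector set \<Rightarrow> ('a \<Rightarrow> 'a) \<Rightarrow> real set" where
  "eigenvalues D A = {\<mu>. \<exists>u \<in> eigenspace D A \<mu>. u \<noteq> 0}"

text \<open>All sequences are indexed by the positive integers \<open>{1..}\<close>; their values at \<open>0\<close> are
  irrelevant. Separability of the Hilbert space is the class \<open>second_countable_topology\<close>, which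
  is equivalent to it for metric spaces.\<close>

locale simple_spectrum_operator =
  fixes D :: "'a::{real_inner, complete_space, second_countable_topology} set"
    and A :: "'a \<Rightarrow> 'a"
    and lam :: "nat \<Rightarrow> real"
    and e :: "nat \<Rightarrow> 'a"
  assumes selfadjoint: "selfadjoint_operator D A"
    and strictly_positive: "strictly_positive_operator D A"
    and compactly_embedded: "compactly_embedded_domain D A"
    and simple_eigenvalues: "\<forall>\<mu> \<in> eigenvalues D A. dim (eigenspace D A \<mu>) = 1"
    and eigenvalues_eq: "eigenvalues D A = lam ` {1..}"
    and lam_pos: "\<forall>n\<ge>1. 0 < lam n"
    and lam_strict_mono: "strict_mono_on {1..} lam"
    and lam_at_top: "filterlim lam at_top sequentially"
    and eigenvector: "\<forall>n\<ge>1. e n \<in> eigenspace D A (lam n)"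
    and orthonormal: "\<forall>m\<ge>1. \<forall>n\<ge>1. e m \<bullet> e n = (if m = n then 1 else 0)"
    and complete_basis: "closure (span (e ` {1..})) = UNIV"

text \<open>The power \<open>A\<^sup>s\<close> (for \<open>s \<ge> 0\<close>) is given by the spectral calculus in the
  eigenbasis; consistency with \<open>A\<close> for \<open>s = 1\<close> is proved below.\<close>

definition power_domain :: "(nat \<Rightarrow> real) \<Rightarrow> (nat \<Rightarrow> 'a::real_inner) \<Rightarrow> real \<Rightarrow> 'a set" where
  "power_domain lam e s = {u. (\<lambda>n. (lam n powr s * (u \<bullet> e n))\<^sup>2) summable_on {1..}}"

definition op_power :: "(nat \<Rightarrow> real) \<Rightarrow> (nat \<Rightarrow> 'a::real_inner) \<Rightarrow> real \<Rightarrow> 'a \<Rightarrow> 'a" where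
  "op_power lam e s u = (\<Sum>\<^sub>\<infinity>n\<in>{1..}. (lam n powr s * (u \<bullet> e n)) *\<^sub>R e n)"

definition Hspace :: "(nat \<Rightarrow> real) \<Rightarrow> (nat \<Rightarrow> 'a::real_inner) \<Rightarrow> real \<Rightarrow> 'a set" where
  "Hspace lam e r = power_domain lam e (r / 2)"

definition Hinner :: "(nat \<Rightarrow> real) \<Rightarrow> (nat \<Rightarrow> 'a::real_inner) \<Rightarrow> real \<Rightarrow> 'a \<Rightarrow> 'a \<Rightarrow> real" where
  "Hinner lam e r u v = op_power lam e (r / 2) u \<bullet> op_power lam e (r / 2) v"

definition Hnorm :: "(nat \<Rightarrow> real) \<Rightarrow> (nat \<Rightarrow> 'a::real_inner) \<Rightarrow> real \<Rightarrow> 'a \<Rightarrow> real" where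
  "Hnorm lam e r u = norm (op_power lam e (r / 2) u)"

definition C_coeff ::
  "(nat \<Rightarrow> real) \<Rightarrow> (nat \<Rightarrow> 'a::real_inner) \<Rightarrow> real \<Rightarrow> real \<Rightarrow> 'a \<Rightarrow> real" where
  "C_coeff lam e \<beta> \<rho> u = \<beta> + \<rho> * (Hnorm lam e 1 u)\<^sup>2"

definition weak_solution ::
  "(nat \<Rightarrow> real) \<Rightarrow> (nat \<Rightarrow> 'a::real_inner) \<Rightarrow> real \<Rightarrow> real \<Rightarrow> real \<Rightarrow> 'a \<Rightarrow> 'a \<Rightarrow> bool" where
  "weak_solution lam e \<beta> \<rho> k u v \<longleftrightarrow>
     u \<in> Hspace lam e 2 \<and> v \<in> Hspace lam e 2 \<and>
     (\<forall>\<phi> \<in> Hspace lam e 2. \<forall>\<psi> \<in> Hspace lam e 2.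
        Hinner lam e 2 u \<phi> + C_coeff lam e \<beta> \<rho> u * Hinner lam e 1 u \<phi> + k * ((u - v) \<bullet> \<phi>) = 0 \<and>
        Hinner lam e 2 v \<psi> + C_coeff lam e \<beta> \<rho> v * Hinner lam e 1 v \<psi> - k * ((u - v) \<bullet> \<psi>) = 0)"

definition bimodal_solution ::
  "(nat \<Rightarrow> real) \<Rightarrow> (nat \<Rightarrow> 'a::real_inner) \<Rightarrow> real \<Rightarrow> real \<Rightarrow> real \<Rightarrow>
     nat \<Rightarrow> nat \<Rightarrow> 'a \<Rightarrow> 'a \<Rightarrow> bool" where
  "bimodal_solution lam e \<beta> \<rho> k n1 n2 u v \<longleftrightarrow>
     n1 \<noteq> n2 \<and> weak_solution lam e \<beta> \<rho> k u v \<and>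
     (\<exists>a1 a2 c1 c2. a1 \<noteq> 0 \<and> a2 \<noteq> 0 \<and> c1 \<noteq> 0 \<and> c2 \<noteq> 0 \<and>
        u = a1 *\<^sub>R e n1 + a2 *\<^sub>R e n2 \<and> v = c1 *\<^sub>R e n1 + c2 *\<^sub>R e n2)"

definition equidistributed_solution ::
  "(nat \<Rightarrow> real) \<Rightarrow> (nat \<Rightarrow> 'a::real_inner) \<Rightarrow> real \<Rightarrow> real \<Rightarrow> real \<Rightarrow> 'a \<Rightarrow> 'a \<Rightarrow> bool" where
  "equidistributed_solution lam e \<beta> \<rho> k u v \<longleftrightarrow>
     weak_solution lam e \<beta> \<rho> k u v \<and> (u, v) \<noteq> (0, 0) \<and> Hnorm lam e 1 u = Hnorm lam e 1 v"

definition bimodal_equidistributed ::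
  "(nat \<Rightarrow> real) \<Rightarrow> (nat \<Rightarrow> 'a::real_inner) \<Rightarrow> real \<Rightarrow> real \<Rightarrow> real \<Rightarrow>
     nat \<Rightarrow> nat \<Rightarrow> ('a \<times> 'a) set" where
  "bimodal_equidistributed lam e \<beta> \<rho> k n1 n2 =
     {(u, v). bimodal_solution lam e \<beta> \<rho> k n1 n2 u v \<and> equidistributed_solution lam e \<beta> \<rho> k u v}"

definition B1 :: "(nat \<Rightarrow> real) \<Rightarrow> real \<Rightarrow> real \<Rightarrow> (nat \<times> nat) set" where
  "B1 lam \<beta> k = {(n1, n2). 1 \<le> n1 \<and> n1 < n2 \<and> lam n1 + lam n2 < - \<beta> \<and> lam n1 * lam n2 = 2 * k}"

definition B2 :: "(nat \<Rightarrow> real) \<Rightarrow> real \<Rightarrow> real \<Rightarrow> (nat \<times> nat) set" where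
  "B2 lam \<beta> k = {(n1, n2). 1 \<le> n1 \<and> n1 < n2 \<and> lam n2 < - \<beta> \<and> lam n1 * (lam n2 - lam n1) = 2 * k}"

definition BB :: "(nat \<Rightarrow> real) \<Rightarrow> real \<Rightarrow> real \<Rightarrow> (nat \<times> nat) set" where
  "BB lam \<beta> k = B1 lam \<beta> k \<union> B2 lam \<beta> k"

context simple_spectrum_operator
begin

lemma has_sum_metric_iff:
  fixes f :: "'b \<Rightarrow> 'c::{comm_monoid_add, metric_space}"
  shows "(f has_sum l) S \<longleftrightarrow> (\<forall>\<epsilon>>0. \<exists>X. finite X \<and> X \<subseteq> S \<and>
    (\<forall>Y. finite Y \<and> X \<subseteq> Y \<and> Y \<subseteq> S \<longrightarrow> dist (sum f Y) l < \<epsilon>))"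
  unfolding has_sum_def tendsto_iff eventually_finite_subsets_at_top by blast

lemma orthonormal_simp: "m \<ge> 1 \<Longrightarrow> n \<ge> 1 \<Longrightarrow> e m \<bullet> e n = (if m = n then 1 else 0)"
  using orthonormal by blast

lemma has_sum_basis: "((\<lambda>n. (w \<bullet> e n) *\<^sub>R e n) has_sum w) {1..}"
proof -
  let ?P = "\<lambda>F. \<Sum>n\<in>F. (w \<bullet> e n) *\<^sub>R e n"
  have coord: "(w - ?P F) \<bullet> e m = 0" if "finite F" "F \<subseteq> {1..}" "m \<in> F" for F m
  proof -
    have "?P F \<bullet> e m = (\<Sum>n\<in>F. (w \<bullet> e n) * (e n \<bullet> e m))"
      by (simp add: inner_sum_left)
    also have "\<dots> = (\<Sum>n\<in>F. if n = m then w \<bullet> e m else 0)"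
    proof (rule sum.cong)
      fix n assume "n \<in> F"
      then have "e n \<bullet> e m = (if n = m then 1 else 0)" using that by (intro orthonormal_simp) auto
      then show "(w \<bullet> e n) * (e n \<bullet> e m) = (if n = m then w \<bullet> e m else 0)" by simp
    qed simp
    also have "\<dots> = w \<bullet> e m" using that by simp
    finally show ?thesis by (simp add: inner_diff_left)
  qed
  have best: "norm (w - ?P F) \<le> norm (w - s)" if F: "finite F" "F \<subseteq> {1..}" and s: "s \<in> span (e ` F)" for F s
  proof -
    have orth: "(w - ?P F) \<bullet> t = 0" if "t \<in> span (e ` F)" for t
      using that
    proof (induction rule: span_induct_alt)
      case base show ?case by simp
    next
      case (step c x y) then show ?case using coord[OF F] by (auto simp: inner_add_right)
    qed
    have "?P F - s \<in> span (e ` F)"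
      by (intro span_diff s span_sum span_scale span_base) auto
    then have "norm (w - s) ^ 2 = norm (w - ?P F) ^ 2 + norm (?P F - s) ^ 2"
      using norm_add_Pythagorean[of "w - ?P F" "?P F - s"] orth
      by (simp add: orthogonal_def)
    then have "norm (w - ?P F) ^ 2 \<le> norm (w - s) ^ 2" by simp
    then show ?thesis by (rule power2_le_imp_le) simp
  qed
  show ?thesis
    unfolding has_sum_metric_iff
  proof (intro allI impI)
    fix \<epsilon> :: real assume "\<epsilon> > 0"
    have "w \<in> closure (span (e ` {1..}))" using complete_basis by auto
    then obtain s where s: "s \<in> span (e ` {1..})" "dist s w < \<epsilon>"
      using \<open>\<epsilon> > 0\<close> unfolding closure_approachable by blast
    obtain T r where T: "finite T" "T \<subseteq> e ` {1..}" and r: "s = (\<Sum>a\<in>T. r a *\<^sub>R a)"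
      using s(1) unfolding span_explicit by blast
    have sT: "s \<in> span T" unfolding r by (intro span_sum span_scale span_base)
    obtain F where F: "F \<subseteq> {1..}" "finite F" "T = e ` F"
      using finite_subset_image[OF T(1,2)] by blast
    show "\<exists>X. finite X \<and> X \<subseteq> {1..} \<and>
        (\<forall>Y. finite Y \<and> X \<subseteq> Y \<and> Y \<subseteq> {1..} \<longrightarrow> dist (?P Y) w < \<epsilon>)"
    proof (intro exI[of _ F] conjI F allI impI)
      fix Y assume Y: "finite Y \<and> F \<subseteq> Y \<and> Y \<subseteq> {1..}"
      have "s \<in> span (e ` Y)" using sT F(3) Y span_mono[of "e ` F" "e ` Y"] by blast
      then have "norm (w - ?P Y) \<le> norm (w - s)" using Y best by blast
      then show "dist (?P Y) w < \<epsilon>" using s(2) by (simp add: dist_norm norm_minus_commute)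
    qed
  qed
qed

lemma inner_op_basis:
  assumes "u \<in> D" "n \<ge> 1" shows "A u \<bullet> e n = lam n * (u \<bullet> e n)"
proof -
  have "e n \<in> D" "A (e n) = lam n *\<^sub>R e n" using eigenvector assms(2) by (auto simp: eigenspace_def)
  then have "\<forall>u\<in>D. A u \<bullet> e n = u \<bullet> (lam n *\<^sub>R e n)"
    using selfadjoint unfolding selfadjoint_operator_def by blast
  then show ?thesis using assms(1) by simp
qed

lemma bilinear_has_sum:
  "((\<lambda>n. (w \<bullet> e n) * (z \<bullet> e n)) has_sum (w \<bullet> z)) {1..}"
proof -
  have "((\<lambda>x. x \<bullet> z) \<circ> (\<lambda>n. (w \<bullet> e n) *\<^sub>R e n) has_sum (w \<bullet> z)) {1..}"
    by (rule has_sum_comm_additive_general[OF _ _ has_sum_basis])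
       (auto simp: inner_sum_left intro!: tendsto_intros)
  then show ?thesis by (simp add: o_def inner_commute)
qed

lemma coeff_has_sum:
  assumes "((\<lambda>n. c n *\<^sub>R e n) has_sum z) {1..}" "m \<ge> 1"
  shows "z \<bullet> e m = c m"
proof -
  have "((\<lambda>x. x \<bullet> e m) \<circ> (\<lambda>n. c n *\<^sub>R e n) has_sum (z \<bullet> e m)) {1..}"
    by (rule has_sum_comm_additive_general[OF _ _ assms(1)])
       (auto simp: inner_sum_left intro!: tendsto_intros)
  then have 1: "((\<lambda>n. if n = m then c m else 0) has_sum (z \<bullet> e m)) {1..}"
    by (rule has_sum_cong[THEN iffD1, rotated]) (use assms(2) orthonormal in auto)
  have "((\<lambda>n. if n = m then c m else 0) has_sum c m) {m}"
    using has_sum_finite[of "{m}" "\<lambda>n. if n = m then c m else 0"] by simp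
  then have "((\<lambda>n. if n = m then c m else 0) has_sum c m) {1..}"
    by (rule has_sum_cong_neutral[THEN iffD1, rotated 3]) (use assms(2) in auto)
  with 1 show ?thesis by (rule has_sum_unique)
qed

lemma summable_of_square_summable:
  assumes "(\<lambda>n. (c n)\<^sup>2) summable_on {1..}"
  shows "(\<lambda>n. c n *\<^sub>R e n) summable_on {1..}"
proof -
  have sq: "norm (\<Sum>n\<in>F. c n *\<^sub>R e n) ^ 2 = (\<Sum>n\<in>F. (c n)\<^sup>2)" if "finite F" "F \<subseteq> {1..}" for F
  proof -
    have "norm (\<Sum>n\<in>F. c n *\<^sub>R e n) ^ 2 = (\<Sum>n\<in>F. norm (c n *\<^sub>R e n) ^ 2)"
      by (rule norm_sum_Pythagorean[OF that(1)])
         (use that(2) orthonormal in \<open>auto simp: pairwise_def orthogonal_def subset_iff\<close>)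
    also have "\<dots> = (\<Sum>n\<in>F. (c n)\<^sup>2)"
    proof (rule sum.cong)
      fix n assume "n \<in> F"
      then have "norm (e n) = 1" using that(2) orthonormal_simp[of n n] by (auto simp: norm_eq_1)
      then show "norm (c n *\<^sub>R e n) ^ 2 = (c n)\<^sup>2" by simp
    qed simp
    finally show ?thesis .
  qed
  obtain S where S: "((\<lambda>n. (c n)\<^sup>2) has_sum S) {1..}" using assms unfolding summable_on_def by blast
  have "\<exists>X. finite X \<and> X \<subseteq> {1..} \<and>
      (\<forall>Y. finite Y \<and> Y \<subseteq> {1..} \<and> X \<inter> Y = {} \<longrightarrow> norm (\<Sum>n\<in>Y. c n *\<^sub>R e n) < \<epsilon>)" if "\<epsilon> > 0" for \<epsilon>
  proof -
    have "\<epsilon>\<^sup>2 / 2 > 0" using that by simp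
    then obtain X where X: "finite X" "X \<subseteq> {1..}"
      "\<And>Y. finite Y \<Longrightarrow> X \<subseteq> Y \<Longrightarrow> Y \<subseteq> {1..} \<Longrightarrow> dist (\<Sum>n\<in>Y. (c n)\<^sup>2) S < \<epsilon>\<^sup>2 / 2"
      using S unfolding has_sum_metric_iff by meson
    have "norm (\<Sum>n\<in>Y. c n *\<^sub>R e n) < \<epsilon>" if Y: "finite Y" "Y \<subseteq> {1..}" "X \<inter> Y = {}" for Y
    proof -
      have "(\<Sum>n\<in>X \<union> Y. (c n)\<^sup>2) = (\<Sum>n\<in>X. (c n)\<^sup>2) + (\<Sum>n\<in>Y. (c n)\<^sup>2)"
        using X(1) Y by (intro sum.union_disjoint) auto
      moreover have "dist (\<Sum>n\<in>X \<union> Y. (c n)\<^sup>2) S < \<epsilon>\<^sup>2 / 2" using X Y by (intro X(3)) auto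
      moreover have "dist (\<Sum>n\<in>X. (c n)\<^sup>2) S < \<epsilon>\<^sup>2 / 2" using X by (intro X(3)) auto
      ultimately have "(\<Sum>n\<in>Y. (c n)\<^sup>2) < \<epsilon>\<^sup>2" unfolding dist_real_def by linarith
      then have "norm (\<Sum>n\<in>Y. c n *\<^sub>R e n) ^ 2 < \<epsilon>\<^sup>2" using sq Y by simp
      then show ?thesis using \<open>\<epsilon> > 0\<close> by (meson less_imp_le power2_less_imp_less)
    qed
    then show ?thesis using X(1,2) by blast
  qed
  note tails = this
  let ?f = "\<lambda>n. c n *\<^sub>R e n"
  have cauchy: "cauchy_filter (filtermap (sum ?f) (finite_subsets_at_top {1..}))"
    unfolding cauchy_filter_metric_filtermap
  proof (intro allI impI)
    fix \<epsilon> :: real assume "\<epsilon> > 0"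
    then have "\<epsilon> / 2 > 0" by simp
    from tails[OF this] obtain X where X: "finite X" "X \<subseteq> {1..}"
      and Xt: "\<forall>Y. finite Y \<and> Y \<subseteq> {1..} \<and> X \<inter> Y = {} \<longrightarrow> norm (sum ?f Y) < \<epsilon> / 2"
      by (elim exE conjE)
    have near: "dist (sum ?f Y) (sum ?f X) < \<epsilon> / 2" if Y: "finite Y" "X \<subseteq> Y" "Y \<subseteq> {1..}" for Y
    proof -
      have "sum ?f Y - sum ?f X = sum ?f (Y - X)" using Y by (simp add: sum_diff)
      moreover have "norm (sum ?f (Y - X)) < \<epsilon> / 2" using Y by (intro Xt[rule_format]) auto
      ultimately show ?thesis by (simp add: dist_norm)
    qed
    show "\<exists>P. eventually P (finite_subsets_at_top {1..}) \<and>
        (\<forall>Y Z. P Y \<and> P Z \<longrightarrow> dist (sum ?f Y) (sum ?f Z) < \<epsilon>)"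
    proof (intro exI[of _ "\<lambda>Y. finite Y \<and> X \<subseteq> Y \<and> Y \<subseteq> {1..}"] conjI allI impI)
      show "eventually (\<lambda>Y. finite Y \<and> X \<subseteq> Y \<and> Y \<subseteq> {1..}) (finite_subsets_at_top {1..})"
        unfolding eventually_finite_subsets_at_top using X(1,2) by blast
      fix Y Z assume YZ: "(finite Y \<and> X \<subseteq> Y \<and> Y \<subseteq> {1..}) \<and> finite Z \<and> X \<subseteq> Z \<and> Z \<subseteq> {1..}"
      then show "dist (sum ?f Y) (sum ?f Z) < \<epsilon>"
        using near[of Y] near[of Z] by (meson dist_triangle_half_l)
    qed
  qed
  have "complete (UNIV :: 'a set)"
    by (meson Cauchy_convergent UNIV_I complete_def convergent_def)
  then obtain L where "(sum ?f \<longlongrightarrow> L) (finite_subsets_at_top {1..})"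
    using cauchy complete_uniform[where S="UNIV :: 'a set"] by (force simp: filterlim_def)
  then show ?thesis unfolding summable_on_def has_sum_def by blast
qed

theorem power_domain_1: "power_domain lam e 1 = D"
proof (intro equalityI subsetI)
  fix u assume "u \<in> D"
  have "((\<lambda>n. (A u \<bullet> e n) * (A u \<bullet> e n)) has_sum (A u \<bullet> A u)) {1..}" by (rule bilinear_has_sum)
  then have "((\<lambda>n. (lam n powr 1 * (u \<bullet> e n))\<^sup>2) has_sum (A u \<bullet> A u)) {1..}"
    by (rule has_sum_cong[THEN iffD1, rotated])
       (use lam_pos inner_op_basis \<open>u \<in> D\<close> in \<open>auto simp: power2_eq_square\<close>)
  then show "u \<in> power_domain lam e 1" unfolding power_domain_def summable_on_def by blast
next
  fix u assume "u \<in> power_domain lam e 1"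
  then have "(\<lambda>n. (lam n powr 1 * (u \<bullet> e n)) *\<^sub>R e n) summable_on {1..}"
    unfolding power_domain_def by (intro summable_of_square_summable) simp
  then obtain z where z: "((\<lambda>n. (lam n powr 1 * (u \<bullet> e n)) *\<^sub>R e n) has_sum z) {1..}"
    unfolding summable_on_def by blast
  have "A w \<bullet> u = w \<bullet> z" if "w \<in> D" for w
  proof -
    have "((\<lambda>n. (A w \<bullet> e n) * (u \<bullet> e n)) has_sum (A w \<bullet> u)) {1..}" by (rule bilinear_has_sum)
    moreover have "((\<lambda>n. (w \<bullet> e n) * (z \<bullet> e n)) has_sum (w \<bullet> z)) {1..}" by (rule bilinear_has_sum)
    then have "((\<lambda>n. (A w \<bullet> e n) * (u \<bullet> e n)) has_sum (w \<bullet> z)) {1..}"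
      by (rule has_sum_cong[THEN iffD1, rotated])
         (use lam_pos inner_op_basis[OF that] coeff_has_sum[OF z] in auto)
    ultimately show ?thesis by (rule has_sum_unique)
  qed
  then show "u \<in> D" using selfadjoint unfolding selfadjoint_operator_def by blast
qed

theorem op_power_1:
  assumes "u \<in> D" shows "op_power lam e 1 u = A u"
proof -
  have "((\<lambda>n. (lam n powr 1 * (u \<bullet> e n)) *\<^sub>R e n) has_sum A u) {1..}"
    using has_sum_basis[of "A u"]
    by (rule has_sum_cong[THEN iffD1, rotated]) (use lam_pos inner_op_basis assms in auto)
  then show ?thesis unfolding op_power_def by (rule infsumI)
qed

end

end

theory Submission
  imports Defs
begin

text \<open>On the mode \<open>e\<^sub>n\<close> the two equations, added and subtracted, become
  \<open>(\<lambda>\<^sub>n\<^sup>2 + C \<lambda>\<^sub>n) (\<alpha>\<^sub>n + \<gamma>\<^sub>n) = 0\<close> and \<open>(\<lambda>\<^sub>n\<^sup>2 + C \<lambda>\<^sub>n + 2 k) (\<alpha>\<^sub>n - \<gamma>\<^sub>n) = 0\<close>, where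
  \<open>C = C\<^sub>u = C\<^sub>v\<close>. Hence every active mode is either in phase, with \<open>C = - \<lambda>\<^sub>n\<close>, or in antiphase,
  with \<open>\<lambda>\<^sub>n\<^sup>2 + C \<lambda>\<^sub>n + 2 k = 0\<close>. For two modes with \<open>\<lambda>\<^sub>m < \<lambda>\<^sub>n\<close>, comparing the two values of \<open>C\<close> leaves
  only antiphase/antiphase, with \<open>C = - (\<lambda>\<^sub>m + \<lambda>\<^sub>n)\<close> (the set \<open>B1\<close>), and antiphase/in phase, with
  \<open>C = - \<lambda>\<^sub>n\<close> (the set \<open>B2\<close>). The definition of \<open>C\<close> then becomes an ellipse for the amplitudes,
  which is nondegenerate exactly when the inequality in \<open>B1\<close> or \<open>B2\<close> holds.\<close>

section \<open>Scalar algebra of the mode equations\<close>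

lemma mode_equations_iff:
  fixes l a c C k :: real
  assumes "k > 0" "l > 0" "a \<noteq> 0"
  shows "l\<^sup>2 * a + C * (l * a) + k * (a - c) = 0 \<and> l\<^sup>2 * c + C * (l * c) - k * (a - c) = 0
    \<longleftrightarrow> c = a \<and> C = - l \<or> c = - a \<and> l\<^sup>2 + C * l + 2 * k = 0"
    (is "?L \<longleftrightarrow> ?R")
proof
  assume L: ?L
  \<comment> \<open>This is the sum of the two equations: the coupling terms cancel.\<close>
  then have "l * ((l + C) * (a + c)) = 0" by (simp add: power2_eq_square) algebra
  then consider "l + C = 0" | "c = - a" using assms by auto
  then show ?R
  proof cases
    case 1
    then have C: "C = - l" by simp
    \<comment> \<open>With \<open>C = - l\<close> the first two terms of the first equation cancel,
      so only the coupling survives and \<open>k > 0\<close> forces \<open>c = a\<close>.\<close>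
    have "k * (a - c) = 0" using L unfolding C by (simp add: power2_eq_square)
    then show ?thesis using assms C by simp
  next
    case 2
    have "a * (l\<^sup>2 + C * l + 2 * k) = 0" using L unfolding 2 by (simp add: algebra_simps)
    then show ?thesis using assms 2 by simp
  qed
next
  assume ?R
  then show ?L
  proof (elim disjE conjE)
    assume "c = a" "C = - l"
    then show ?L by (simp add: power2_eq_square)
  next
    assume *: "c = - a" "l\<^sup>2 + C * l + 2 * k = 0"
    have "a * (l\<^sup>2 + C * l + 2 * k) = 0" using * by simp
    moreover have "l\<^sup>2 * a + C * (l * a) + k * (a - c) = a * (l\<^sup>2 + C * l + 2 * k)"
      "l\<^sup>2 * c + C * (l * c) - k * (a - c) = - (a * (l\<^sup>2 + C * l + 2 * k))"
      unfolding *(1) by (simp_all add: algebra_simps)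
    ultimately show ?L by simp
  qed
qed

text \<open>Of the four phase combinations, in phase on both modes needs \<open>l1 = l2\<close>. In
  phase on the lower mode with antiphase on the upper one needs
  \<open>l2 * (l2 - l1) + 2 * k = 0\<close>, whose left side is positive. This is where the order
  \<open>l1 < l2\<close> breaks the symmetry between the modes.\<close>

lemma two_mode_equations_iff:
  fixes l1 l2 a1 a2 c1 c2 C k :: real
  assumes "k > 0" "l1 > 0" "l1 < l2" "a1 \<noteq> 0" "a2 \<noteq> 0"
  shows "(l1\<^sup>2 * a1 + C * (l1 * a1) + k * (a1 - c1) = 0 \<and> l1\<^sup>2 * c1 + C * (l1 * c1) - k * (a1 - c1) = 0) \<and>
      (l2\<^sup>2 * a2 + C * (l2 * a2) + k * (a2 - c2) = 0 \<and> l2\<^sup>2 * c2 + C * (l2 * c2) - k * (a2 - c2) = 0)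
    \<longleftrightarrow> c1 = - a1 \<and> c2 = - a2 \<and> C = - (l1 + l2) \<and> l1 * l2 = 2 * k
      \<or> c1 = - a1 \<and> c2 = a2 \<and> C = - l2 \<and> l1 * (l2 - l1) = 2 * k"
    (is "?L \<longleftrightarrow> ?R")
proof -
  have l2: "l2 > 0" using assms by simp
  have "?L \<longleftrightarrow> (c1 = a1 \<and> C = - l1 \<or> c1 = - a1 \<and> l1\<^sup>2 + C * l1 + 2 * k = 0) \<and>
      (c2 = a2 \<and> C = - l2 \<or> c2 = - a2 \<and> l2\<^sup>2 + C * l2 + 2 * k = 0)"
    by (simp only: mode_equations_iff[OF assms(1,2,4)] mode_equations_iff[OF assms(1) l2 assms(5)])
  moreover have "\<not> (C = - l1 \<and> l2\<^sup>2 + C * l2 + 2 * k = 0)"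
  proof
    assume *: "C = - l1 \<and> l2\<^sup>2 + C * l2 + 2 * k = 0"
    have "l2 * (l2 - l1) > 0" using assms l2 by simp
    moreover have "l2 * (l2 - l1) + 2 * k = 0"
      using * by (auto simp: power2_eq_square algebra_simps)
    ultimately show False using assms(1) by linarith
  qed
  moreover have "C = - l2 \<Longrightarrow> l1\<^sup>2 + C * l1 + 2 * k = 0 \<longleftrightarrow> l1 * (l2 - l1) = 2 * k"
    by (auto simp: power2_eq_square algebra_simps)
  moreover have "l1\<^sup>2 + C * l1 + 2 * k = 0 \<and> l2\<^sup>2 + C * l2 + 2 * k = 0
    \<longleftrightarrow> C = - (l1 + l2) \<and> l1 * l2 = 2 * k"
  proof
    assume *: "l1\<^sup>2 + C * l1 + 2 * k = 0 \<and> l2\<^sup>2 + C * l2 + 2 * k = 0"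
    \<comment> \<open>Both eigenvalues are roots of the quadratic
      \<open>X\<^sup>2 + C * X + 2 * k\<close>; subtracting gives their sum, and substituting back
      gives their product, as in Vieta's formulas.\<close>
    then have "(l2 - l1) * (l1 + l2 + C) = 0" by (simp add: power2_eq_square) algebra
    then have C: "C = - (l1 + l2)" using assms by auto
    show "C = - (l1 + l2) \<and> l1 * l2 = 2 * k"
      using * unfolding C by (simp add: power2_eq_square algebra_simps)
  next
    assume *: "C = - (l1 + l2) \<and> l1 * l2 = 2 * k"
    then have C: "C = - (l1 + l2)" by blast
    show "l1\<^sup>2 + C * l1 + 2 * k = 0 \<and> l2\<^sup>2 + C * l2 + 2 * k = 0"
      using * unfolding C by (simp add: power2_eq_square algebra_simps)
  qed
  moreover have "- l1 \<noteq> - l2" using assms by simp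
  ultimately show ?thesis by metis
qed

text \<open>Every abscissa strictly between \<open>0\<close> and \<open>sqrt (M / p)\<close> carries
  a point of the ellipse with positive ordinate, so the projection to the first axis contains a
  nonempty open interval.\<close>

lemma infinite_ellipse_points:
  fixes p q M :: real
  assumes "p > 0" "q > 0" "M > 0"
  shows "infinite {(x, y). p * x\<^sup>2 + q * y\<^sup>2 = M \<and> x * y \<noteq> 0}" (is "infinite ?E")
proof
  assume "finite ?E"
  then have "finite (fst ` ?E)" by simp
  moreover have "{0<..<sqrt (M / p)} \<subseteq> fst ` ?E"
  proof
    fix x assume x: "x \<in> {0<..<sqrt (M / p)}"
    then have "x\<^sup>2 < M / p"
      using real_sqrt_less_iff[of "x\<^sup>2" "M / p"] by simp
    then have pos: "M - p * x\<^sup>2 > 0" using assms by (simp add: field_simps)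
    then have "(x, sqrt ((M - p * x\<^sup>2) / q)) \<in> ?E" using x assms by simp
    then show "x \<in> fst ` ?E" by force
  qed
  ultimately have "finite {0<..<sqrt (M / p)}" by (rule rev_finite_subset)
  then show False using assms by (simp add: infinite_Ioo)
qed

text \<open>Reduces the existence claim, which ranges over pairs in either order, to pairs with the
  smaller index first.\<close>

lemma bimodal_equidistributed_commute:
  "bimodal_equidistributed lam e \<beta> \<rho> k n1 n2 = bimodal_equidistributed lam e \<beta> \<rho> k n2 n1"
proof -
  have "bimodal_solution lam e \<beta> \<rho> k n2 n1 u v"
    if "bimodal_solution lam e \<beta> \<rho> k n1 n2 u v" for n1 n2 u v
  proof -
    from that obtain a1 a2 c1 c2 where "a1 \<noteq> 0" "a2 \<noteq> 0" "c1 \<noteq> 0" "c2 \<noteq> 0"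
      "u = a2 *\<^sub>R e n2 + a1 *\<^sub>R e n1" "v = c2 *\<^sub>R e n2 + c1 *\<^sub>R e n1"
      unfolding bimodal_solution_def by (auto simp: add.commute)
    then show ?thesis using that unfolding bimodal_solution_def by blast
  qed
  then show ?thesis unfolding bimodal_equidistributed_def by blast
qed

section \<open>Spectral powers of the operator and the scale of spaces\<close>

context simple_spectrum_operator
begin

text \<open>Membership in the power domain guarantees that the defining series converges; for a
  divergent series \<open>infsum\<close> would return its default value \<open>0\<close>.\<close>

lemma op_power_inner_basis:
  assumes "u \<in> power_domain lam e s" "n \<ge> 1"
  shows "op_power lam e s u \<bullet> e n = lam n powr s * (u \<bullet> e n)"
proof -
  have "(\<lambda>n. (lam n powr s * (u \<bullet> e n)) *\<^sub>R e n) summable_on {1..}"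
    using assms(1) unfolding power_domain_def by (intro summable_of_square_summable) simp
  from coeff_has_sum[OF has_sum_infsum[OF this] assms(2)] show ?thesis
    unfolding op_power_def .
qed

text \<open>Needed because test functions are taken in \<open>Hspace lam e 2\<close> but are also
  paired in the inner product of order 1. The weight for \<open>s\<close> is dominated by
  \<open>1\<close> plus the weight for \<open>t\<close>, and the constant part is summable by
  Parseval's identity.\<close>

lemma power_domain_antimono:
  assumes "0 \<le> s" "s \<le> t"
  shows "power_domain lam e t \<subseteq> power_domain lam e s"
proof
  fix u assume u: "u \<in> power_domain lam e t"
  have "(\<lambda>n. (u \<bullet> e n)\<^sup>2) summable_on {1..}"
    using bilinear_has_sum[of u u] unfolding power2_eq_square summable_on_def by blast
  then have "(\<lambda>n. (u \<bullet> e n)\<^sup>2 + (lam n powr t * (u \<bullet> e n))\<^sup>2) summable_on {1..}"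
    using u unfolding power_domain_def by (intro summable_on_add) auto
  then have "(\<lambda>n. (lam n powr s * (u \<bullet> e n))\<^sup>2) summable_on {1..}"
  proof (rule summable_on_comparison_test)
    fix n :: nat assume "n \<in> {1..}"
    then have l: "lam n > 0" using lam_pos by simp
    have "(lam n powr s)\<^sup>2 \<le> 1 + (lam n powr t)\<^sup>2"
    proof (cases "lam n \<le> 1")
      case True
      then have "lam n powr s \<le> 1" using l assms by (simp add: powr_le1)
      then have "(lam n powr s)\<^sup>2 \<le> 1" by (simp add: power_le_one)
      then show ?thesis by (simp add: add_increasing2)
    next
      case False
      then have "lam n powr s \<le> lam n powr t" using assms by (intro powr_mono) auto
      then have "(lam n powr s)\<^sup>2 \<le> (lam n powr t)\<^sup>2" by (intro power_mono) auto
      then show ?thesis by linarith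
    qed
    then have "(lam n powr s)\<^sup>2 * (u \<bullet> e n)\<^sup>2 \<le> (1 + (lam n powr t)\<^sup>2) * (u \<bullet> e n)\<^sup>2"
      by (rule mult_right_mono) simp
    then show "(lam n powr s * (u \<bullet> e n))\<^sup>2 \<le> (u \<bullet> e n)\<^sup>2 + (lam n powr t * (u \<bullet> e n))\<^sup>2"
      by (simp add: power_mult_distrib algebra_simps)
  qed auto
  then show "u \<in> power_domain lam e s" unfolding power_domain_def by simp
qed

section \<open>Vectors supported on two distinct modes\<close>

context
  fixes m n :: nat
  assumes m: "m \<ge> 1" and n: "n \<ge> 1" and mn: "m \<noteq> n"
begin

lemma two_mode_inner_basis:
  "j \<ge> 1 \<Longrightarrow> (a *\<^sub>R e m + b *\<^sub>R e n) \<bullet> e j = (if j = m then a else if j = n then b else 0)"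
  using m n mn orthonormal_simp[of m j] orthonormal_simp[of n j] by (auto simp: inner_add_left)

lemma two_mode_power_domain: "a *\<^sub>R e m + b *\<^sub>R e n \<in> power_domain lam e s"
proof -
  have "(\<lambda>j. (lam j powr s * ((a *\<^sub>R e m + b *\<^sub>R e n) \<bullet> e j))\<^sup>2) summable_on {m, n}"
    by (rule summable_on_finite) simp
  then have "(\<lambda>j. (lam j powr s * ((a *\<^sub>R e m + b *\<^sub>R e n) \<bullet> e j))\<^sup>2) summable_on {1..}"
    by (rule summable_on_cong_neutral[THEN iffD1, rotated 3])
       (use m n in \<open>auto simp: two_mode_inner_basis\<close>)
  then show ?thesis unfolding power_domain_def by simp
qed

lemma op_power_two_mode:
  "op_power lam e s (a *\<^sub>R e m + b *\<^sub>R e n) =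
    (lam m powr s * a) *\<^sub>R e m + (lam n powr s * b) *\<^sub>R e n"
proof -
  let ?f = "\<lambda>j. (lam j powr s * ((a *\<^sub>R e m + b *\<^sub>R e n) \<bullet> e j)) *\<^sub>R e j"
  have "infsum ?f {1..} = infsum ?f {m, n}"
    by (rule infsum_cong_neutral) (use m n in \<open>auto simp: two_mode_inner_basis\<close>)
  also have "\<dots> = ?f m + ?f n" using mn by simp
  finally show ?thesis using m n mn unfolding op_power_def by (simp add: two_mode_inner_basis)
qed

text \<open>The two half powers, one from each factor, combine into \<open>lam m powr r\<close> and
  \<open>lam n powr r\<close>. The hypothesis on \<open>\<phi>\<close> is what makes the coordinates
  of its half power available.\<close>

lemma Hinner_two_mode:
  assumes "\<phi> \<in> Hspace lam e r"
  shows "Hinner lam e r (a *\<^sub>R e m + b *\<^sub>R e n) \<phi> =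
    lam m powr r * a * (\<phi> \<bullet> e m) + lam n powr r * b * (\<phi> \<bullet> e n)"
proof -
  have sq: "lam j powr (r / 2) * lam j powr (r / 2) = lam j powr r" for j
    by (simp add: powr_add[symmetric])
  have "Hinner lam e r (a *\<^sub>R e m + b *\<^sub>R e n) \<phi> =
      (lam m powr (r / 2) * lam m powr (r / 2)) * a * (\<phi> \<bullet> e m) +
      (lam n powr (r / 2) * lam n powr (r / 2)) * b * (\<phi> \<bullet> e n)"
    using assms m n unfolding Hinner_def Hspace_def op_power_two_mode
    by (simp add: inner_add_left inner_commute[of "e _"] op_power_inner_basis del: powr_half_sqrt)
  then show ?thesis unfolding sq .
qed

lemma Hnorm_1_two_mode:
  "(Hnorm lam e 1 (a *\<^sub>R e m + b *\<^sub>R e n))\<^sup>2 = lam m * a\<^sup>2 + lam n * b\<^sup>2"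
proof -
  have "(Hnorm lam e 1 (a *\<^sub>R e m + b *\<^sub>R e n))\<^sup>2 =
      Hinner lam e 1 (a *\<^sub>R e m + b *\<^sub>R e n) (a *\<^sub>R e m + b *\<^sub>R e n)"
    by (simp add: Hnorm_def Hinner_def power2_norm_eq_inner)
  also have "\<dots> = lam m * a\<^sup>2 + lam n * b\<^sup>2"
    using m n mn lam_pos two_mode_power_domain
    by (simp add: Hinner_two_mode Hspace_def two_mode_inner_basis power2_eq_square less_imp_le)
  finally show ?thesis .
qed

text \<open>For two-mode vectors each weak equation is a linear combination of
  \<open>\<phi> \<bullet> e m\<close> and \<open>\<phi> \<bullet> e n\<close>, so it holds for all
  test functions exactly when both coefficients vanish. The coefficients \<open>Cu\<close> and
  \<open>Cv\<close> may still differ here.\<close>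

lemma weak_solution_two_mode_iff:
  fixes a1 a2 c1 c2 \<beta> \<rho> k :: real
  defines "Cu \<equiv> \<beta> + \<rho> * (lam m * a1\<^sup>2 + lam n * a2\<^sup>2)"
    and "Cv \<equiv> \<beta> + \<rho> * (lam m * c1\<^sup>2 + lam n * c2\<^sup>2)"
  shows "weak_solution lam e \<beta> \<rho> k (a1 *\<^sub>R e m + a2 *\<^sub>R e n) (c1 *\<^sub>R e m + c2 *\<^sub>R e n) \<longleftrightarrow>
    ((lam m)\<^sup>2 * a1 + Cu * (lam m * a1) + k * (a1 - c1) = 0 \<and>
     (lam m)\<^sup>2 * c1 + Cv * (lam m * c1) - k * (a1 - c1) = 0) \<and>
    ((lam n)\<^sup>2 * a2 + Cu * (lam n * a2) + k * (a2 - c2) = 0 \<and>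
     (lam n)\<^sup>2 * c2 + Cv * (lam n * c2) - k * (a2 - c2) = 0)"
    (is "weak_solution _ _ _ _ _ ?u ?v \<longleftrightarrow> (?Eum = 0 \<and> ?Evm = 0) \<and> (?Eun = 0 \<and> ?Evn = 0)")
proof -
  have l: "lam m > 0" "lam n > 0" using lam_pos m n by auto
  have uv: "?u \<in> Hspace lam e 2" "?v \<in> Hspace lam e 2"
    unfolding Hspace_def by (rule two_mode_power_domain)+
  have C: "C_coeff lam e \<beta> \<rho> ?u = Cu" "C_coeff lam e \<beta> \<rho> ?v = Cv"
    unfolding C_coeff_def Cu_def Cv_def Hnorm_1_two_mode by simp_all
  have eqs: "Hinner lam e 2 ?u \<phi> + Cu * Hinner lam e 1 ?u \<phi> + k * ((?u - ?v) \<bullet> \<phi>)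
        = ?Eum * (\<phi> \<bullet> e m) + ?Eun * (\<phi> \<bullet> e n)"
      "Hinner lam e 2 ?v \<phi> + Cv * Hinner lam e 1 ?v \<phi> - k * ((?u - ?v) \<bullet> \<phi>)
        = ?Evm * (\<phi> \<bullet> e m) + ?Evn * (\<phi> \<bullet> e n)"
    if "\<phi> \<in> Hspace lam e 2" for \<phi>
  proof -
    have "\<phi> \<in> Hspace lam e 1"
      using that power_domain_antimono[of "1/2" 1] unfolding Hspace_def by auto
    then have H: "Hinner lam e 1 (a *\<^sub>R e m + b *\<^sub>R e n) \<phi>
          = lam m * a * (\<phi> \<bullet> e m) + lam n * b * (\<phi> \<bullet> e n)"
      "Hinner lam e 2 (a *\<^sub>R e m + b *\<^sub>R e n) \<phi>
          = (lam m)\<^sup>2 * a * (\<phi> \<bullet> e m) + (lam n)\<^sup>2 * b * (\<phi> \<bullet> e n)" for a b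
      using that l by (simp_all add: Hinner_two_mode)
    have d: "(?u - ?v) \<bullet> \<phi> = (a1 - c1) * (\<phi> \<bullet> e m) + (a2 - c2) * (\<phi> \<bullet> e n)"
      by (simp add: inner_add_left inner_diff_left inner_commute[of "e _"] algebra_simps)
    show "Hinner lam e 2 ?u \<phi> + Cu * Hinner lam e 1 ?u \<phi> + k * ((?u - ?v) \<bullet> \<phi>)
        = ?Eum * (\<phi> \<bullet> e m) + ?Eun * (\<phi> \<bullet> e n)"
      "Hinner lam e 2 ?v \<phi> + Cv * Hinner lam e 1 ?v \<phi> - k * ((?u - ?v) \<bullet> \<phi>)
        = ?Evm * (\<phi> \<bullet> e m) + ?Evn * (\<phi> \<bullet> e n)"
      unfolding H d by (simp_all add: algebra_simps)
  qed
  have basis: "e m \<in> Hspace lam e 2" "e n \<in> Hspace lam e 2"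
    using two_mode_power_domain[of 1 0] two_mode_power_domain[of 0 1]
    unfolding Hspace_def by simp_all
  have ip: "e m \<bullet> e m = 1" "e n \<bullet> e n = 1" "e m \<bullet> e n = 0" "e n \<bullet> e m = 0"
    using m n mn by (simp_all add: orthonormal_simp)
  show ?thesis
  proof
    assume W: "weak_solution lam e \<beta> \<rho> k ?u ?v"
    have "?Eum * (\<phi> \<bullet> e m) + ?Eun * (\<phi> \<bullet> e n) = 0 \<and> ?Evm * (\<phi> \<bullet> e m) + ?Evn * (\<phi> \<bullet> e n) = 0"
      if "\<phi> \<in> Hspace lam e 2" for \<phi>
      using W that unfolding weak_solution_def C by (simp only: eqs[OF that, symmetric])
    \<comment> \<open>Testing with \<open>e m\<close> and then \<open>e n\<close> isolates the
      coefficients.\<close>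
    from this[OF basis(1)] this[OF basis(2)]
    show "(?Eum = 0 \<and> ?Evm = 0) \<and> (?Eun = 0 \<and> ?Evn = 0)" unfolding ip by simp
  next
    assume "(?Eum = 0 \<and> ?Evm = 0) \<and> (?Eun = 0 \<and> ?Evn = 0)"
    then show "weak_solution lam e \<beta> \<rho> k ?u ?v"
      unfolding weak_solution_def C using uv by (auto simp only: eqs mult_zero_left add_0_left)
  qed
qed

section \<open>Classification and infinitude for a fixed pair of modes\<close>

lemma two_mode_eq_iff:
  "a1 *\<^sub>R e m + a2 *\<^sub>R e n = b1 *\<^sub>R e m + b2 *\<^sub>R e n \<longleftrightarrow> a1 = b1 \<and> a2 = b2"
  using m n mn two_mode_inner_basis[of m a1 a2] two_mode_inner_basis[of n a1 a2]
    two_mode_inner_basis[of m b1 b2] two_mode_inner_basis[of n b1 b2] by auto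

text \<open>The resonance conditions sit inside the two sets, so that one formula covers every pair:
  a set is empty when its resonance fails. The inequalities involving \<open>\<beta>\<close> are not
  imposed here; they decide whether the ellipses have points.\<close>

lemma bimodal_equidistributed_eq:
  assumes "\<rho> > 0" "k > 0" "lam m < lam n"
  shows "bimodal_equidistributed lam e \<beta> \<rho> k m n =
    {(x *\<^sub>R e m + y *\<^sub>R e n, - x *\<^sub>R e m - y *\<^sub>R e n) | x y.
      lam m * lam n = 2 * k \<and> \<rho> * x\<^sup>2 * lam m + \<rho> * y\<^sup>2 * lam n + lam m + lam n + \<beta> = 0 \<and> x * y \<noteq> 0} \<union>
    {(x *\<^sub>R e m + y *\<^sub>R e n, - x *\<^sub>R e m + y *\<^sub>R e n) | x y.
      lam m * (lam n - lam m) = 2 * k \<and> \<rho> * x\<^sup>2 * lam m + \<rho> * y\<^sup>2 * lam n + lam n + \<beta> = 0 \<and> x * y \<noteq> 0}"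
    (is "_ = ?S1 \<union> ?S2")
proof -
  define C where "C x y = \<beta> + \<rho> * (lam m * x\<^sup>2 + lam n * y\<^sup>2)" for x y
  have l: "lam m > 0" using lam_pos m by simp
  have equi: "Hnorm lam e 1 (a1 *\<^sub>R e m + a2 *\<^sub>R e n) = Hnorm lam e 1 (c1 *\<^sub>R e m + c2 *\<^sub>R e n)
      \<longleftrightarrow> C c1 c2 = C a1 a2" for a1 a2 c1 c2
  proof -
    have "Hnorm lam e 1 w \<ge> 0" for w by (simp add: Hnorm_def)
    then have "Hnorm lam e 1 u = Hnorm lam e 1 v \<longleftrightarrow> (Hnorm lam e 1 u)\<^sup>2 = (Hnorm lam e 1 v)\<^sup>2" for u v
      by (simp add: power2_eq_iff_nonneg)
    then have "?thesis \<longleftrightarrow> (lam m * a1\<^sup>2 + lam n * a2\<^sup>2 = lam m * c1\<^sup>2 + lam n * c2\<^sup>2 \<longleftrightarrow> C c1 c2 = C a1 a2)"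
      by (simp only: Hnorm_1_two_mode)
    then show ?thesis using assms(1) by (auto simp: C_def)
  qed
  have nz: "a1 *\<^sub>R e m + a2 *\<^sub>R e n \<noteq> 0" if "a1 \<noteq> 0" for a1 a2
    using two_mode_eq_iff[of a1 a2 0 0] that by simp
  have key: "weak_solution lam e \<beta> \<rho> k (a1 *\<^sub>R e m + a2 *\<^sub>R e n) (c1 *\<^sub>R e m + c2 *\<^sub>R e n) \<and>
      C c1 c2 = C a1 a2 \<longleftrightarrow>
      c1 = - a1 \<and> c2 = - a2 \<and> C a1 a2 = - (lam m + lam n) \<and> lam m * lam n = 2 * k
      \<or> c1 = - a1 \<and> c2 = a2 \<and> C a1 a2 = - lam n \<and> lam m * (lam n - lam m) = 2 * k"
    (is "?W \<and> ?C \<longleftrightarrow> ?R") if nz: "a1 \<noteq> 0" "a2 \<noteq> 0" for a1 a2 c1 c2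
  proof -
    \<comment> \<open>Equidistribution identifies the two coefficients, which brings the system into
      the form with a single \<open>C\<close>. Conversely, \<open>?R\<close> gives \<open>?C\<close>
      because amplitudes agree up to sign and enter \<open>C\<close> only through squares.\<close>
    have "?C \<Longrightarrow> ?W \<longleftrightarrow> ?R"
      unfolding weak_solution_two_mode_iff C_def[symmetric]
      using two_mode_equations_iff[OF assms(2) l assms(3) nz] by simp
    moreover have "?R \<Longrightarrow> ?C" by (auto simp: C_def)
    ultimately show ?thesis by blast
  qed
  have C1: "C x y = - (lam m + lam n) \<longleftrightarrow> \<rho> * x\<^sup>2 * lam m + \<rho> * y\<^sup>2 * lam n + lam m + lam n + \<beta> = 0"
    and C2: "C x y = - lam n \<longleftrightarrow> \<rho> * x\<^sup>2 * lam m + \<rho> * y\<^sup>2 * lam n + lam n + \<beta> = 0" for x y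
    unfolding C_def by (auto simp: algebra_simps)
  have "bimodal_equidistributed lam e \<beta> \<rho> k m n =
    {(a1 *\<^sub>R e m + a2 *\<^sub>R e n, c1 *\<^sub>R e m + c2 *\<^sub>R e n) | a1 a2 c1 c2.
      a1 \<noteq> 0 \<and> a2 \<noteq> 0 \<and> c1 \<noteq> 0 \<and> c2 \<noteq> 0 \<and>
      weak_solution lam e \<beta> \<rho> k (a1 *\<^sub>R e m + a2 *\<^sub>R e n) (c1 *\<^sub>R e m + c2 *\<^sub>R e n) \<and> C c1 c2 = C a1 a2}"
    (is "_ = ?T")
  proof (intro equalityI subrelI)
    fix u v assume "(u, v) \<in> bimodal_equidistributed lam e \<beta> \<rho> k m n"
    then obtain a1 a2 c1 c2 where "a1 \<noteq> 0" "a2 \<noteq> 0" "c1 \<noteq> 0" "c2 \<noteq> 0"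
      "u = a1 *\<^sub>R e m + a2 *\<^sub>R e n" "v = c1 *\<^sub>R e m + c2 *\<^sub>R e n"
      "weak_solution lam e \<beta> \<rho> k u v" "Hnorm lam e 1 u = Hnorm lam e 1 v"
      unfolding bimodal_equidistributed_def bimodal_solution_def equidistributed_solution_def by auto
    then show "(u, v) \<in> ?T" using equi by blast
  next
    fix u v assume "(u, v) \<in> ?T"
    then obtain a1 a2 c1 c2 where *: "a1 \<noteq> 0" "a2 \<noteq> 0" "c1 \<noteq> 0" "c2 \<noteq> 0"
      "u = a1 *\<^sub>R e m + a2 *\<^sub>R e n" "v = c1 *\<^sub>R e m + c2 *\<^sub>R e n"
      "weak_solution lam e \<beta> \<rho> k u v" "C c1 c2 = C a1 a2" by auto
    then have "u \<noteq> 0" "Hnorm lam e 1 u = Hnorm lam e 1 v" using nz equi by auto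
    with * mn show "(u, v) \<in> bimodal_equidistributed lam e \<beta> \<rho> k m n"
      unfolding bimodal_equidistributed_def bimodal_solution_def equidistributed_solution_def
      by blast
  qed
  also have "\<dots> = {(a1 *\<^sub>R e m + a2 *\<^sub>R e n, c1 *\<^sub>R e m + c2 *\<^sub>R e n) | a1 a2 c1 c2.
      a1 \<noteq> 0 \<and> a2 \<noteq> 0 \<and> (c1 = - a1 \<and> c2 = - a2 \<and> C a1 a2 = - (lam m + lam n) \<and> lam m * lam n = 2 * k
      \<or> c1 = - a1 \<and> c2 = a2 \<and> C a1 a2 = - lam n \<and> lam m * (lam n - lam m) = 2 * k)}"
    \<comment> \<open>The conditions that \<open>c1\<close> and \<open>c2\<close> be nonzero are
      absorbed, since either alternative makes them equal to \<open>a1\<close> and \<open>a2\<close>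
      up to sign.\<close>
    by (intro Collect_cong ex_cong1) (use key in auto)
  also have "\<dots> = ?S1 \<union> ?S2"
  proof -
    \<comment> \<open>Matches the subtraction in \<open>?S1\<close> with the form
      \<open>c1 *\<^sub>R e m + c2 *\<^sub>R e n\<close>.\<close>
    have "- x *\<^sub>R e m - y *\<^sub>R e n = - x *\<^sub>R e m + - y *\<^sub>R e n" for x y by simp
    then show ?thesis unfolding C1 C2 mult_eq_0_iff by (simp only:) blast
  qed
  finally show ?thesis .
qed

text \<open>The first component alone determines \<open>x\<close> and \<open>y\<close>, so the
  second may be an arbitrary \<open>f\<close>; this lets the lemma serve both families.
  \<open>M\<close> collects the constant terms of the ellipse equation.\<close>

lemma infinite_two_mode_ellipse:
  assumes "\<rho> > 0" "M < 0"
  shows "infinite {(x *\<^sub>R e m + y *\<^sub>R e n, f x y) | x y.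
    \<rho> * x\<^sup>2 * lam m + \<rho> * y\<^sup>2 * lam n + M = 0 \<and> x * y \<noteq> 0}" (is "infinite ?S")
proof -
  let ?E = "{(x, y). \<rho> * lam m * x\<^sup>2 + \<rho> * lam n * y\<^sup>2 = - M \<and> x * y \<noteq> 0}"
  let ?g = "\<lambda>(x, y). (x *\<^sub>R e m + y *\<^sub>R e n, f x y)"
  have "infinite ?E" using assms lam_pos m n by (intro infinite_ellipse_points) auto
  moreover have "inj_on ?g ?E" by (auto simp: inj_on_def two_mode_eq_iff)
  moreover have "?g ` ?E \<subseteq> ?S"
  proof
    fix p assume "p \<in> ?g ` ?E"
    then obtain x y where "p = (x *\<^sub>R e m + y *\<^sub>R e n, f x y)" "x * y \<noteq> 0"
      "\<rho> * lam m * x\<^sup>2 + \<rho> * lam n * y\<^sup>2 = - M" by auto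
    moreover from this(3) have "\<rho> * x\<^sup>2 * lam m + \<rho> * y\<^sup>2 * lam n + M = 0"
      by (simp add: mult_ac)
    ultimately show "p \<in> ?S" by blast
  qed
  ultimately show ?thesis by (meson finite_imageD finite_subset)
qed

end

end

section \<open>From fixed pairs to the full statement\<close>

theorem theorem5p4:
  fixes D :: "'a::{real_inner, complete_space, second_countable_topology} set"
    and A :: "'a \<Rightarrow> 'a"
    and lam :: "nat \<Rightarrow> real"
    and e :: "nat \<Rightarrow> 'a"
    and \<beta> \<rho> k :: real
  assumes "simple_spectrum_operator D A lam e"
    and "\<rho> > 0" and "k > 0"
  shows "((\<exists>n1\<ge>1. \<exists>n2\<ge>1. n1 \<noteq> n2 \<and> bimodal_equidistributed lam e \<beta> \<rho> k n1 n2 \<noteq> {})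
            \<longleftrightarrow> BB lam \<beta> k \<noteq> {}) \<and>
    (\<forall>n1 n2. 1 \<le> n1 \<and> n1 < n2 \<longrightarrow>
       \<not> ((n1, n2) \<in> B1 lam \<beta> k \<and> (n1, n2) \<in> B2 lam \<beta> k) \<and>
       ((n1, n2) \<in> B1 lam \<beta> k \<longrightarrow>
          bimodal_equidistributed lam e \<beta> \<rho> k n1 n2 =
            {(x *\<^sub>R e n1 + y *\<^sub>R e n2, - x *\<^sub>R e n1 - y *\<^sub>R e n2) | x y.
               \<rho> * x\<^sup>2 * lam n1 + \<rho> * y\<^sup>2 * lam n2 + lam n1 + lam n2 + \<beta> = 0 \<and> x * y \<noteq> 0} \<and>
          infinite (bimodal_equidistributed lam e \<beta> \<rho> k n1 n2)) \<and>
       ((n1, n2) \<in> B2 lam \<beta> k \<longrightarrow>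
          bimodal_equidistributed lam e \<beta> \<rho> k n1 n2 =
            {(x *\<^sub>R e n1 + y *\<^sub>R e n2, - x *\<^sub>R e n1 + y *\<^sub>R e n2) | x y.
               \<rho> * x\<^sup>2 * lam n1 + \<rho> * y\<^sup>2 * lam n2 + lam n2 + \<beta> = 0 \<and> x * y \<noteq> 0} \<and>
          infinite (bimodal_equidistributed lam e \<beta> \<rho> k n1 n2)) \<and>
       ((n1, n2) \<notin> BB lam \<beta> k \<longrightarrow> bimodal_equidistributed lam e \<beta> \<rho> k n1 n2 = {}))"
proof -
  interpret simple_spectrum_operator D A lam e by fact
  note \<rho> = assms(2) and k = assms(3)
  have pair: "\<not> ((n1, n2) \<in> B1 lam \<beta> k \<and> (n1, n2) \<in> B2 lam \<beta> k) \<and>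
       ((n1, n2) \<in> B1 lam \<beta> k \<longrightarrow>
          bimodal_equidistributed lam e \<beta> \<rho> k n1 n2 =
            {(x *\<^sub>R e n1 + y *\<^sub>R e n2, - x *\<^sub>R e n1 - y *\<^sub>R e n2) | x y.
               \<rho> * x\<^sup>2 * lam n1 + \<rho> * y\<^sup>2 * lam n2 + lam n1 + lam n2 + \<beta> = 0 \<and> x * y \<noteq> 0} \<and>
          infinite (bimodal_equidistributed lam e \<beta> \<rho> k n1 n2)) \<and>
       ((n1, n2) \<in> B2 lam \<beta> k \<longrightarrow>
          bimodal_equidistributed lam e \<beta> \<rho> k n1 n2 =
            {(x *\<^sub>R e n1 + y *\<^sub>R e n2, - x *\<^sub>R e n1 + y *\<^sub>R e n2) | x y.
               \<rho> * x\<^sup>2 * lam n1 + \<rho> * y\<^sup>2 * lam n2 + lam n2 + \<beta> = 0 \<and> x * y \<noteq> 0} \<and>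
          infinite (bimodal_equidistributed lam e \<beta> \<rho> k n1 n2)) \<and>
       ((n1, n2) \<notin> BB lam \<beta> k \<longrightarrow> bimodal_equidistributed lam e \<beta> \<rho> k n1 n2 = {})"
    if n12: "1 \<le> n1" "n1 < n2" for n1 n2
  proof -
    have n: "n1 \<ge> 1" "n2 \<ge> 1" "n1 \<noteq> n2" using n12 by auto
    have l: "lam n1 > 0" "lam n2 > 0" using lam_pos n by auto
    have less: "lam n1 < lam n2"
      using lam_strict_mono n12 by (auto simp: strict_mono_on_def)
    note eq = bimodal_equidistributed_eq[OF n \<rho> k less, of \<beta>]
    \<comment> \<open>Both resonances together would give \<open>(lam n1)\<^sup>2 = 0\<close>. This
      yields disjointness of \<open>B1\<close> and \<open>B2\<close>, and below it empties the set
      belonging to the other resonance.\<close>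
    have excl: "\<not> (lam n1 * lam n2 = 2 * k \<and> lam n1 * (lam n2 - lam n1) = 2 * k)"
      using l by (auto simp: algebra_simps)
    \<comment> \<open>A point with \<open>x * y \<noteq> 0\<close> makes the quadratic part strictly
      positive, so the constant part is negative: exactly the inequality in \<open>B1\<close> or
      \<open>B2\<close>. Hence any solution places the pair in one of these sets.\<close>
    have ellipse_pos: "0 < \<rho> * x\<^sup>2 * lam n1 + \<rho> * y\<^sup>2 * lam n2" if "x * y \<noteq> 0" for x y
      using that \<rho> l by (intro add_pos_pos mult_pos_pos) auto
    have case1: "(n1, n2) \<in> B1 lam \<beta> k"
      if "lam n1 * lam n2 = 2 * k" "x * y \<noteq> 0"
        "\<rho> * x\<^sup>2 * lam n1 + \<rho> * y\<^sup>2 * lam n2 + lam n1 + lam n2 + \<beta> = 0" for x y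
      using that n12 ellipse_pos[of x y] unfolding B1_def by auto
    have case2: "(n1, n2) \<in> B2 lam \<beta> k"
      if "lam n1 * (lam n2 - lam n1) = 2 * k" "x * y \<noteq> 0"
        "\<rho> * x\<^sup>2 * lam n1 + \<rho> * y\<^sup>2 * lam n2 + lam n2 + \<beta> = 0" for x y
      using that n12 ellipse_pos[of x y] unfolding B2_def by auto
    have "\<not> ((n1, n2) \<in> B1 lam \<beta> k \<and> (n1, n2) \<in> B2 lam \<beta> k)"
      using excl unfolding B1_def B2_def by blast
    moreover have "bimodal_equidistributed lam e \<beta> \<rho> k n1 n2 =
            {(x *\<^sub>R e n1 + y *\<^sub>R e n2, - x *\<^sub>R e n1 - y *\<^sub>R e n2) | x y.
               \<rho> * x\<^sup>2 * lam n1 + \<rho> * y\<^sup>2 * lam n2 + lam n1 + lam n2 + \<beta> = 0 \<and> x * y \<noteq> 0} \<and>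
          infinite (bimodal_equidistributed lam e \<beta> \<rho> k n1 n2)" (is "?b = ?S \<and> _")
      if "(n1, n2) \<in> B1 lam \<beta> k"
    proof -
      have B: "lam n1 * lam n2 = 2 * k" "lam n1 + lam n2 + \<beta> < 0"
        using that unfolding B1_def by auto
      then have "?b = ?S" unfolding eq using excl by simp
      moreover have "infinite ?S"
        \<comment> \<open>Here \<open>M\<close> is \<open>lam n1 + lam n2 + \<beta>\<close>;
          reassociating the sum matches it with the displayed equation.\<close>
        using infinite_two_mode_ellipse[OF n \<rho> B(2), of "\<lambda>x y. - x *\<^sub>R e n1 - y *\<^sub>R e n2"]
        by (simp add: add.assoc)
      ultimately show ?thesis by simp
    qed
    moreover have "bimodal_equidistributed lam e \<beta> \<rho> k n1 n2 =
            {(x *\<^sub>R e n1 + y *\<^sub>R e n2, - x *\<^sub>R e n1 + y *\<^sub>R e n2) | x y.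
               \<rho> * x\<^sup>2 * lam n1 + \<rho> * y\<^sup>2 * lam n2 + lam n2 + \<beta> = 0 \<and> x * y \<noteq> 0} \<and>
          infinite (bimodal_equidistributed lam e \<beta> \<rho> k n1 n2)" (is "?b = ?S \<and> _")
      if "(n1, n2) \<in> B2 lam \<beta> k"
    proof -
      have B: "lam n1 * (lam n2 - lam n1) = 2 * k" "lam n2 + \<beta> < 0"
        using that unfolding B2_def by auto
      then have "?b = ?S" unfolding eq using excl by simp
      moreover have "infinite ?S"
        using infinite_two_mode_ellipse[OF n \<rho> B(2), of "\<lambda>x y. - x *\<^sub>R e n1 + y *\<^sub>R e n2"]
        by (simp add: add.assoc)
      ultimately show ?thesis by simp
    qed
    moreover have "bimodal_equidistributed lam e \<beta> \<rho> k n1 n2 = {}" if "(n1, n2) \<notin> BB lam \<beta> k"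
      unfolding eq using that case1 case2 unfolding BB_def by blast
    ultimately show ?thesis by blast
  qed
  have nonempty: "(\<exists>n1\<ge>1. \<exists>n2\<ge>1. n1 \<noteq> n2 \<and> bimodal_equidistributed lam e \<beta> \<rho> k n1 n2 \<noteq> {})
            \<longleftrightarrow> BB lam \<beta> k \<noteq> {}"
  proof
    assume "\<exists>n1\<ge>1. \<exists>n2\<ge>1. n1 \<noteq> n2 \<and> bimodal_equidistributed lam e \<beta> \<rho> k n1 n2 \<noteq> {}"
    then obtain n1 n2 where n: "n1 \<ge> 1" "n2 \<ge> 1" "n1 \<noteq> n2"
      "bimodal_equidistributed lam e \<beta> \<rho> k n1 n2 \<noteq> {}" by blast
    from n(3) consider "n1 < n2" | "n2 < n1" by linarith
    then show "BB lam \<beta> k \<noteq> {}"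
    proof cases
      case 1
      then show ?thesis using pair[of n1 n2] n by blast
    next
      case 2
      then show ?thesis
        using pair[of n2 n1] n bimodal_equidistributed_commute[of lam e \<beta> \<rho> k n1 n2] by auto
    qed
  next
    assume "BB lam \<beta> k \<noteq> {}"
    then obtain n1 n2 where B: "(n1, n2) \<in> B1 lam \<beta> k \<union> B2 lam \<beta> k" unfolding BB_def by auto
    then have n: "1 \<le> n1" "n1 < n2" unfolding B1_def B2_def by auto
    \<comment> \<open>Infinitude in the first two situations also provides the existence of a
      solution.\<close>
    have "infinite (bimodal_equidistributed lam e \<beta> \<rho> k n1 n2)" using pair[OF n] B by blast
    then have "bimodal_equidistributed lam e \<beta> \<rho> k n1 n2 \<noteq> {}" by auto
    moreover have "n2 \<ge> 1" "n1 \<noteq> n2" using n by auto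
    ultimately show "\<exists>n1\<ge>1. \<exists>n2\<ge>1. n1 \<noteq> n2 \<and> bimodal_equidistributed lam e \<beta> \<rho> k n1 n2 \<noteq> {}"
      using n(1) by blast
  qed
  show ?thesis by (intro conjI[OF nonempty] allI impI, rule pair) auto
qed

end
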